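(* For $\beta>0$ let $\Sigma_\beta^2$ be the limiting variance of the one-dimensional Dunkel–Hänggi (DH) diffusion, i.e. $$\Sigma_\beta^2=2\;\frac{\displaystyle\int_0^\infty\psi_\beta(r)\,e^{-\beta\sqrt{1+r^2}}\,\frac{r}{1+r^2}\,dr}{\displaystyle\int_0^\infty\frac{e^{-\beta\sqrt{1+r^2}}}{\sqrt{1+r^2}}\,dr},$$ with $\psi_\beta$ as defined in the context. Then $$\Sigma_\beta^2\sim\frac{2}{\beta}\quad\text{as }\beta\to\infty,$$ and there is a constant $A>0$ such that $$\Sigma_\beta^2\sim\frac{A}{\log(1/\beta)}\quad\text{as }\beta\to0^+ .$$
   Context: The one-dimensional DH diffusion is the process $(x_t,p_t)$ in $\mathbb R\times\mathbb R$ solving, with $r_t=|p_t|$, $\theta_t=p_t/r_t$ and $W,w$ independent standard real Brownian motions, $$dx_t=f(r_t)p_t\,dt,\qquad dp_t=-b(r_t)p_t\,dt+\sigma(r_t)\big(\beta[1+\eta(r_t)^2]\big)^{-1/2}[dW_t+\eta(r_t)\theta_t\,dw_t],$$ where $f(r)=(1+r^2)^{-1/2}$, $b(r)=1$, $\sigma(r)=\sqrt{2\sqrt{1+r^2}}$, $\eta(r)=r$. Correspondingly $g(r)=\frac{2rb(r)}{\sigma^2(r)}=\frac{r}{\sqrt{1+r^2}}$ and $h(r)=\frac{2rf(r)}{\sigma^2(r)}=\frac{r}{1+r^2}$. Fix $\varepsilon\in(0,1)$, so that $g\ge\varepsilon$ for large $r$. The function $\psi_\beta\in C^2(\mathbb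 R_+,\mathbb R)$ is the solution of $$\psi_\beta''(r)-\beta\,g(r)\,\psi_\beta'(r)+\beta\,h(r)=0$$ such that $\psi_\beta(0)=0$ and, for some $\varepsilon'<\frac{\beta\varepsilon}{2}$, $|\psi_\beta(r)|=O(e^{\varepsilon' r})$ and $|\psi_\beta'(r)|=O(e^{\varepsilon' r})$ as $r\to\infty$. $u\sim v$ means that the ratio $u/v$ tends to $1$ in the indicated limit. *)

theory Defs
  imports "HOL-Analysis.Analysis" "HOL-Library.Landau_Symbols"
begin

text \<open>Coefficients of the one-dimensional Dunkel--Haenggi diffusion, as functions of
  \<open>r = \<bar>p\<bar>\<close>.\<close>

definition dh_f :: "real \<Rightarrow> real" where
  "dh_f r = 1 / sqrt (1 + r\<^sup>2)"

definition dh_b :: "real \<Rightarrow> real" where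
  "dh_b r = 1"

definition dh_sigma :: "real \<Rightarrow> real" where
  "dh_sigma r = sqrt (2 * sqrt (1 + r\<^sup>2))"

definition dh_g :: "real \<Rightarrow> real" where
  "dh_g r = 2 * r * dh_b r / (dh_sigma r)\<^sup>2"

definition dh_h :: "real \<Rightarrow> real" where
  "dh_h r = 2 * r * dh_f r / (dh_sigma r)\<^sup>2"

lemma dh_g_eq: "dh_g r = r / sqrt (1 + r\<^sup>2)"
  by (simp add: dh_g_def dh_b_def dh_sigma_def)

lemma dh_h_eq: "dh_h r = r / (1 + r\<^sup>2)"
proof -
  have "sqrt (1 + r\<^sup>2) * sqrt (1 + r\<^sup>2) = 1 + r\<^sup>2"
    by simp
  then show ?thesis
    by (simp add: dh_h_def dh_f_def dh_sigma_def)
qed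

text \<open>Here \<open>C\<^sup>2(\<real>\<^sub>+)\<close> is \<open>C\<^sup>2\<close> on the closed half-line \<open>{0..}\<close>, with one-sided derivatives at \<open>0\<close>.
  Nothing is required of \<open>\<psi>\<close> at negative arguments.\<close>

definition dh_psi_solution :: "real \<Rightarrow> real \<Rightarrow> (real \<Rightarrow> real) \<Rightarrow> bool" where
  "dh_psi_solution \<epsilon> \<beta> \<psi> \<longleftrightarrow>
    (\<exists>\<psi>' \<psi>'' :: real \<Rightarrow> real.
      (\<forall>r\<ge>0. (\<psi> has_real_derivative \<psi>' r) (at r within {0..})) \<and>
      (\<forall>r\<ge>0. (\<psi>' has_real_derivative \<psi>'' r) (at r within {0..})) \<and>
      continuous_on {0..} \<psi>'' \<and>
      (\<forall>r\<ge>0. \<psi>'' r - \<beta> * dh_g r * \<psi>' r + \<beta> * dh_h r = 0) \<and>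
      \<psi> 0 = 0 \<and>
      (\<exists>\<epsilon>'. \<epsilon>' < \<beta> * \<epsilon> / 2 \<and>
        \<psi> \<in> O[at_top](\<lambda>r. exp (\<epsilon>' * r)) \<and>
        \<psi>' \<in> O[at_top](\<lambda>r. exp (\<epsilon>' * r))))"

text \<open>A function on \<open>\<real>\<^sub>+\<close> is represented by its extension by \<open>0\<close> to the negative reals, so that
  uniqueness on \<open>\<real>\<^sub>+\<close> gives uniqueness as a HOL function.\<close>

definition dh_psi :: "real \<Rightarrow> real \<Rightarrow> real \<Rightarrow> real" where
  "dh_psi \<epsilon> \<beta> = (THE \<psi>. dh_psi_solution \<epsilon> \<beta> \<psi> \<and> (\<forall>r<0. \<psi> r = 0))"

definition dh_variance :: "real \<Rightarrow> real \<Rightarrow> real" where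
  "dh_variance \<epsilon> \<beta> =
    2 * ((LBINT r:{0..}. dh_psi \<epsilon> \<beta> r * exp (- \<beta> * sqrt (1 + r\<^sup>2)) * (r / (1 + r\<^sup>2))) /
         (LBINT r:{0..}. exp (- \<beta> * sqrt (1 + r\<^sup>2)) / sqrt (1 + r\<^sup>2)))"

end

theory Submission
  imports Defs "HOL-Real_Asymp.Real_Asymp"
begin

text \<open>
  Write \<open>G r = sqrt (1 + r\<^sup>2)\<close>, called \<open>energy\<close> below. Since \<open>G' = dh_g\<close> and \<open>dh_h = G' / G\<close>, the
  equation for \<open>\<psi>\<^sub>\<beta>'\<close> is a linear first-order equation that the substitution \<open>v = \<beta> * G r\<close> solves in
  closed form: with the exponential integral \<open>E1 x = \<integral> exp (- t) / t dt\<close> over \<open>t \<ge> x\<close>, the only solution that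
  grows more slowly than \<open>exp (\<beta> * r)\<close> is \<open>\<psi>\<^sub>\<beta>' r = \<beta> * exp (\<beta> * G r) * E1 (\<beta> * G r)\<close>, because all others differ
  from it by a multiple of \<open>exp (\<beta> * G r)\<close> (\<open>dh_psi_eq\<close>).

  The weight \<open>exp (- \<beta> * G r) * dh_h r\<close> in the numerator is minus the derivative of \<open>E1 (\<beta> * G r)\<close>.
  Integration by parts (\<open>numer_by_parts\<close>) therefore gives
  \<open>\<Sigma>\<^sub>\<beta>\<^sup>2 = 2 N / D\<close> with \<open>N = \<integral> \<beta> exp (\<beta> G) E1 (\<beta> G)\<^sup>2 dr\<close> and \<open>D = \<integral> exp (- \<beta> G) / G dr\<close>, both over
  the half-line.

  For large \<open>\<beta>\<close>, the bounds \<open>exp (- x) / (x + 1) \<le> E1 x \<le> exp (- x) / x\<close> show that \<open>\<beta> * N\<close> is close to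
  \<open>\<integral> exp (- \<beta> G) / G\<^sup>2 dr\<close>. The weight concentrates at \<open>r = 0\<close>, where \<open>G = 1\<close>, so this is close to \<open>D\<close>; the
  identity \<open>weight_concentration\<close> bounds the error by \<open>D / \<beta>\<close>. Hence \<open>\<beta> * N / D\<close> tends to \<open>1\<close>.

  For small \<open>\<beta>\<close>, the variable \<open>u = \<beta> * r\<close> turns \<open>N\<close> into \<open>\<integral> F (sqrt (\<beta>\<^sup>2 + u\<^sup>2)) du\<close> with
  \<open>F x = exp x * (E1 x)\<^sup>2\<close>, which tends to the finite positive constant \<open>\<integral> F u du\<close> by dominated
  convergence (\<open>numer_at_right_0\<close>). The denominator differs from \<open>E1 \<beta>\<close>, and thus from
  \<open>ln (1 / \<beta>)\<close>, by an amount that is negligible against \<open>ln (1 / \<beta>)\<close> (\<open>denom_log_asymp\<close>). The constant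
  of the theorem is \<open>A = 2 \<integral> F u du\<close>.
\<close>

section \<open>Integration over half-lines\<close>

text \<open>
  Signed integrands with one-sided derivatives at the left end point are needed below, so
  integrability is assumed instead of nonnegativity of the integrand.
\<close>

lemma set_integral_FTC_atLeast:
  fixes f F :: "real \<Rightarrow> real"
  assumes deriv: "\<And>x. a \<le> x \<Longrightarrow> (F has_real_derivative f x) (at x within {a..})"
    and cont: "continuous_on {a..} f"
    and int: "set_integrable lborel {a..} f"
    and lim: "(F \<longlongrightarrow> L) at_top"
  shows "(LBINT x:{a..}. f x) = L - F a"
proof -
  have fin: "(LBINT x:{a..b}. f x) = F b - F a" if "a \<le> b" for b
    unfolding set_lebesgue_integral_def
  proof (rule integral_FTC_Icc[OF that])
    show "(F has_vector_derivative f x) (at x within {a..b})" if "a \<le> x" "x \<le> b" for x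
      using DERIV_subset[OF deriv[OF that(1)], of "{a..b}"]
      by (simp add: has_real_derivative_iff_has_vector_derivative subset_iff)
    show "continuous_on {a..b} f"
      using cont by (rule continuous_on_subset) auto
  qed
  have "((\<lambda>b. LBINT x:{a..b}. f x) \<longlongrightarrow> (LBINT x:{a..}. f x)) at_top"
    by (rule tendsto_set_lebesgue_integral_at_top[OF _ int]) auto
  moreover have "((\<lambda>b. LBINT x:{a..b}. f x) \<longlongrightarrow> L - F a) at_top"
  proof (rule Lim_transform_eventually)
    show "((\<lambda>b. F b - F a) \<longlongrightarrow> L - F a) at_top"
      by (intro tendsto_intros lim)
    show "\<forall>\<^sub>F b in at_top. F b - F a = (LBINT x:{a..b}. f x)"
      using eventually_ge_at_top[of a] by eventually_elim (simp add: fin)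
  qed
  ultimately show ?thesis
    by (rule tendsto_unique[OF trivial_limit_at_top_linorder])
qed

lemma set_integrable_lborel_nonneg:
  fixes f :: "real \<Rightarrow> real"
  assumes "f integrable_on A" and "\<And>x. x \<in> A \<Longrightarrow> 0 \<le> f x"
    and "set_borel_measurable borel A f"
  shows "set_integrable lborel A f"
proof -
  have "integrable (completion lborel) (\<lambda>x. indicator A x *\<^sub>R f x)"
    using nonnegative_absolutely_integrable_1[OF assms(1,2)] by (simp add: set_integrable_def)
  moreover have "(\<lambda>x. indicator A x *\<^sub>R f x) \<in> borel_measurable lborel"
    using assms(3) by (simp add: set_borel_measurable_def)
  ultimately show ?thesis
    by (simp add: set_integrable_def integrable_completion)
qed

lemma set_integrable_exp_decay:
  fixes f :: "real \<Rightarrow> real"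
  assumes "0 < b" and cont: "continuous_on {a..} f"
    and bound: "\<And>x. a \<le> x \<Longrightarrow> \<bar>f x\<bar> \<le> C * exp (- b * x)"
  shows "set_integrable lborel {a..} f"
proof (rule set_integrable_bound)
  have "set_integrable lborel {a..} (\<lambda>x. exp (- b * x))"
  proof (rule set_integrable_lborel_nonneg)
    show "(\<lambda>x. exp (- b * x)) integrable_on {a..}"
      using has_integral_exp_minus_to_infinity[OF \<open>0 < b\<close>, of a] by blast
    show "set_borel_measurable borel {a..} (\<lambda>x. exp (- b * x))"
      by (intro set_measurable_continuous_on continuous_intros) auto
  qed auto
  then show "set_integrable lborel {a..} (\<lambda>x. C * exp (- b * x))"
    by simp
  show "set_borel_measurable lborel {a..} f"
    using set_measurable_continuous_on[OF _ cont] by (simp add: set_borel_measurable_def)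
  show "AE x in lborel. x \<in> {a..} \<longrightarrow> norm (f x) \<le> norm (C * exp (- b * x))"
    using bound by (intro AE_I2) force
qed

section \<open>The exponential integral\<close>

text \<open>
  For \<open>x > 0\<close> this is the exponential integral \<open>E\<^sub>1\<close>; only positive arguments have a meaning, since
  the integrand is not integrable near \<open>0\<close>.
\<close>

definition E1 :: "real \<Rightarrow> real" where
  "E1 x = (LBINT t:{x..}. exp (- t) / t)"

lemma E1_integrable:
  fixes x :: real
  assumes "0 < x" shows "set_integrable lborel {x..} (\<lambda>t. exp (- t) / t)"
proof (rule set_integrable_exp_decay[where b = 1 and C = "1 / x"])
  show "\<bar>exp (- t) / t\<bar> \<le> (1 / x) * exp (- 1 * t)" if "x \<le> t" for t
    using that assms by (simp add: frac_le)
  show "continuous_on {x..} (\<lambda>t. exp (- t) / t)"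
    using assms by (intro continuous_intros) auto
qed simp

lemma LBINT_exp_minus: "(LBINT t:{x..}. exp (- t)) = exp (- x :: real)"
proof -
  have "(LBINT t:{x..}. exp (- t)) = 0 - (- exp (- x :: real))"
  proof (rule set_integral_FTC_atLeast)
    show "((\<lambda>x. - exp (- x)) \<longlongrightarrow> (0::real)) at_top" by real_asymp
    show "set_integrable lborel {x..} (\<lambda>t. exp (- t))"
      by (rule set_integrable_exp_decay[where b = 1 and C = 1]) (auto intro!: continuous_intros)
  qed (auto intro!: derivative_eq_intros continuous_intros)
  then show ?thesis by simp
qed

lemma E1_nonneg: "0 < x \<Longrightarrow> 0 \<le> E1 x"
  unfolding E1_def set_lebesgue_integral_def
  by (intro integral_nonneg_AE AE_I2) (auto simp: indicator_def)

lemma E1_le: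
  assumes "0 < x" shows "E1 x \<le> exp (- x) / x"
proof -
  have int: "set_integrable lborel {x..} (\<lambda>t. exp (- t) * (1/x))"
    by (rule set_integrable_exp_decay[where b = 1 and C = "1/x"])
      (use assms in \<open>auto intro!: continuous_intros\<close>)
  have "E1 x \<le> (LBINT t:{x..}. exp (- t) * (1/x))"
    unfolding E1_def
    by (rule set_integral_mono[OF E1_integrable int]) (use assms in \<open>auto simp: frac_le\<close>)
  then show ?thesis by (simp only: set_integral_mult_left LBINT_exp_minus) simp
qed

lemma E1_has_derivative:
  assumes "0 < x" shows "(E1 has_real_derivative - exp (- x) / x) (at x)"
proof -
  define a where "a = x / 2"
  have a: "0 < a" "a < x" using assms by (auto simp: a_def)
  have cont: "continuous_on {a..} (\<lambda>t::real. exp (- t) / t)"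
    using a by (intro continuous_intros) auto
  have eq: "E1 y = E1 a - integral {a..y} (\<lambda>t. exp (- t) / t)" if "a < y" for y
  proof -
    have "E1 a = (LBINT t:{a..y} \<union> {y<..}. exp (- t) / t)"
      unfolding E1_def using that by (simp add: ivl_disj_un)
    also have "\<dots> = (LBINT t:{a..y}. exp (- t) / t) + (LBINT t:{y<..}. exp (- t) / t)"
      by (rule set_integral_Un)
        (use that in \<open>auto intro!: set_integrable_subset[OF E1_integrable[OF a(1)]]\<close>)
    also have "(LBINT t:{a..y}. exp (- t) / t) = integral {a..y} (\<lambda>t. exp (- t) / t)"
      by (rule set_borel_integral_eq_integral)
        (use that in \<open>auto intro!: set_integrable_subset[OF E1_integrable[OF a(1)]]\<close>)
    also have "(LBINT t:{y<..}. exp (- t) / t) = E1 y"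
      unfolding E1_def set_lebesgue_integral_def
      by (rule Bochner_Integration.integral_cong_AE)
        (use AE_lborel_singleton[of y] in \<open>auto simp: indicator_def elim!: eventually_mono\<close>)
    finally show ?thesis by simp
  qed
  have "((\<lambda>y. integral {a..y} (\<lambda>t. exp (- t) / t)) has_real_derivative exp (- x) / x)
      (at x within {a..x + 1})"
    by (rule integral_has_real_derivative)
      (use a in \<open>auto intro: continuous_on_subset[OF cont]\<close>)
  then have "((\<lambda>y. integral {a..y} (\<lambda>t. exp (- t) / t)) has_real_derivative exp (- x) / x) (at x)"
    using a by (subst (asm) at_within_interior) auto
  then have "((\<lambda>y. E1 a - integral {a..y} (\<lambda>t. exp (- t) / t)) has_real_derivative
      - exp (- x) / x) (at x)"
    by (auto intro!: derivative_eq_intros)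
  then show ?thesis
    by (rule has_field_derivative_transform_within_open[of _ _ _ "{a<..}"])
      (use a eq in auto)
qed

lemma E1_tendsto_0: "(E1 \<longlongrightarrow> 0) at_top"
proof (rule tendsto_sandwich[of "\<lambda>_. 0" _ _ "\<lambda>x. exp (- x) / x"])
  show "\<forall>\<^sub>F x in at_top. 0 \<le> E1 x" "\<forall>\<^sub>F x in at_top. E1 x \<le> exp (- x) / x"
    using eventually_gt_at_top[of 0] by (eventually_elim; simp add: E1_nonneg E1_le)+
  show "((\<lambda>x. exp (- x) / x) \<longlongrightarrow> (0::real)) at_top" by real_asymp
qed simp

text \<open>
  Explicit bounds for \<open>E1\<close> come from one principle: two functions that both vanish at infinity are
  ordered oppositely to their derivatives, and the derivative of \<open>E1\<close> is elementary.
\<close>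

lemma E1_compare:
  assumes "0 < x"
    and deriv: "\<And>t. x \<le> t \<Longrightarrow> (B has_real_derivative B' t) (at t)"
    and lim: "(B \<longlongrightarrow> 0) at_top"
  shows E1_ge_compare: "(\<And>t. x \<le> t \<Longrightarrow> - exp (- t) / t \<le> B' t) \<Longrightarrow> B x \<le> E1 x"
    and E1_le_compare: "(\<And>t. x \<le> t \<Longrightarrow> B' t \<le> - exp (- t) / t) \<Longrightarrow> E1 x \<le> B x"
proof -
  have d: "((\<lambda>t. E1 t - B t) has_real_derivative (- exp (- t) / t - B' t)) (at t)" if "x \<le> t" for t
    using that assms(1) by (auto intro!: derivative_eq_intros E1_has_derivative deriv)
  have l: "((\<lambda>t. E1 t - B t) \<longlongrightarrow> 0) at_top"
    using tendsto_diff[OF E1_tendsto_0 lim] by simp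
  show "B x \<le> E1 x" if le: "\<And>t. x \<le> t \<Longrightarrow> - exp (- t) / t \<le> B' t"
  proof -
    have "E1 t - B t \<le> E1 x - B x" if "x \<le> t" for t
      using that d le by (intro DERIV_nonpos_imp_nonincreasing[OF that, of "\<lambda>t. E1 t - B t"]) force
    then have "\<forall>\<^sub>F t in at_top. E1 t - B t \<le> E1 x - B x"
      by (auto simp: eventually_at_top_linorder)
    then have "0 \<le> E1 x - B x"
      by (rule tendsto_upperbound[OF l]) simp
    then show ?thesis by simp
  qed
  show "E1 x \<le> B x" if le: "\<And>t. x \<le> t \<Longrightarrow> B' t \<le> - exp (- t) / t"
  proof -
    have "E1 x - B x \<le> E1 t - B t" if "x \<le> t" for t
      using that d le by (intro DERIV_nonneg_imp_nondecreasing[OF that, of "\<lambda>t. E1 t - B t"]) force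
    then have "\<forall>\<^sub>F t in at_top. E1 x - B x \<le> E1 t - B t"
      by (auto simp: eventually_at_top_linorder)
    then have "E1 x - B x \<le> 0"
      by (rule tendsto_lowerbound[OF l]) simp
    then show ?thesis by simp
  qed
qed

lemma E1_ge:
  assumes "0 < x" shows "exp (- x) / (x + 1) \<le> E1 x"
proof (rule E1_ge_compare[OF assms, where B' = "\<lambda>t. - exp (- t) * (t + 2) / (t + 1)\<^sup>2"])
  show "((\<lambda>x. exp (- x) / (x + 1)) has_real_derivative - exp (- t) * (t + 2) / (t + 1)\<^sup>2) (at t)"
    if "x \<le> t" for t
    using that assms
    by (auto intro!: derivative_eq_intros simp: divide_simps power2_eq_square) (simp add: algebra_simps)
  show "((\<lambda>x::real. exp (- x) / (x + 1)) \<longlongrightarrow> 0) at_top" by real_asymp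
  show "- exp (- t) / t \<le> - exp (- t) * (t + 2) / (t + 1)\<^sup>2" if "x \<le> t" for t
  proof -
    have "(t + 2) / (t + 1)\<^sup>2 \<le> 1 / t"
    proof (rule frac_le_eq[THEN iffD2])
      show "((t + 2) * t - 1 * (t + 1)\<^sup>2) / ((t + 1)\<^sup>2 * t) \<le> 0"
        using that assms by (intro divide_nonpos_pos mult_pos_pos zero_less_power) (auto simp: power2_eq_square algebra_simps)
    qed (use that assms in auto)
    from mult_left_mono[OF this, of "exp (- t)"] show ?thesis by simp
  qed
qed

text \<open>
  The bound \<open>exp (- x) / x\<close> is too large near \<open>0\<close>, where \<open>E1\<close> has a logarithmic singularity. Any
  power \<open>x powr (- a)\<close> with \<open>0 < a\<close> dominates a logarithm; \<open>a = 1 / 4\<close> is small enough that even the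
  square of the bound is integrable at \<open>0\<close>, and then the factor \<open>4 = 1 / a\<close> makes the derivatives
  comparable.
\<close>

lemma E1_le_powr:
  assumes "0 < x" shows "E1 x \<le> 4 * exp (- x) * x powr (- 1 / 4)"
proof (rule E1_le_compare[OF assms,
      where B' = "\<lambda>t. - exp (- t) * (4 * t powr (- 1 / 4) + t powr (- 5 / 4))"])
  show "((\<lambda>x. 4 * exp (- x) * x powr (- 1 / 4)) has_real_derivative
      - exp (- t) * (4 * t powr (- 1 / 4) + t powr (- 5 / 4))) (at t)" if "x \<le> t" for t
    using that assms by (auto intro!: derivative_eq_intros simp: algebra_simps)
  show "((\<lambda>x::real. 4 * exp (- x) * x powr (- 1 / 4)) \<longlongrightarrow> 0) at_top" by real_asymp
  show "- exp (- t) * (4 * t powr (- 1 / 4) + t powr (- 5 / 4)) \<le> - exp (- t) / t"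
    if "x \<le> t" for t
  proof -
    have t: "0 < t" using that assms by simp
    define s where "s = t powr (1 / 4)"
    have s: "0 < s" using t by (simp add: s_def)
    have "s ^ 4 = t" using t by (simp add: s_def powr_power)
    have p: "t powr (- 1 / 4) = inverse s" "t powr (- 5 / 4) = inverse (s * t)"
    proof -
      show "t powr (- 1 / 4) = inverse s" by (simp add: s_def powr_minus[symmetric])
      have "s * t = t powr (1 / 4 + 1)" using t by (simp only: s_def powr_add) simp
      then show "t powr (- 5 / 4) = inverse (s * t)" by (simp add: powr_minus[symmetric])
    qed
    have "s \<le> 4 * t + 1"
    proof (cases "s \<le> 1")
      case False
      then have "s ^ 1 \<le> s ^ 4" by (intro power_increasing) auto
      then show ?thesis using \<open>s ^ 4 = t\<close> t by simp
    qed (use t in simp)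
    then have "1 / t \<le> 4 * t powr (- 1 / 4) + t powr (- 5 / 4)"
      unfolding p using s t by (simp add: divide_simps)
    from mult_left_mono[OF this, of "exp (- t)"] show ?thesis by simp
  qed
qed

lemma exp_minus_slope:
  assumes "0 < (x::real)" shows "0 \<le> 1 / x - exp (- x) / x" "1 / x - exp (- x) / x \<le> 1"
proof -
  have "1 - x \<le> exp (- x)" using exp_ge_add_one_self[of "- x"] by simp
  then show "1 / x - exp (- x) / x \<le> 1" using assms by (simp add: divide_simps)
  show "0 \<le> 1 / x - exp (- x) / x" using assms by (simp add: divide_simps)
qed

text \<open>
  The sum \<open>E1 x + ln x\<close> has its derivative in \<open>[0, 1]\<close>, so on \<open>(0, 1]\<close> it stays within \<open>1\<close> of its value
  at \<open>1\<close>, which lies in \<open>[0, 1]\<close>.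
\<close>

lemma E1_log:
  assumes "0 < x" "x \<le> 1"
  shows "ln (1 / x) - 1 \<le> E1 x" "E1 x \<le> ln (1 / x) + 1"
proof -
  have d: "((\<lambda>t. E1 t + ln t) has_real_derivative (1 / t - exp (- t) / t)) (at t)" if "x \<le> t" for t
    using that assms(1) by (auto intro!: derivative_eq_intros E1_has_derivative)
  have "E1 x + ln x \<le> E1 1 + ln 1"
    using d assms exp_minus_slope(1)
    by (intro DERIV_nonneg_imp_nondecreasing[of x 1 "\<lambda>t. E1 t + ln t"]) force+
  moreover have "E1 1 \<le> 1" using E1_le[of 1] order_trans[of "E1 1" "exp (- 1)" 1] by simp
  ultimately show "E1 x \<le> ln (1 / x) + 1" using assms by (simp add: ln_div)
  have "E1 1 + ln 1 - 1 \<le> E1 x + ln x - x"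
  proof (rule DERIV_nonpos_imp_nonincreasing[of x 1 "\<lambda>t. E1 t + ln t - t"])
    fix t assume t: "x \<le> t" "t \<le> 1"
    have "((\<lambda>t. E1 t + ln t - t) has_real_derivative (1 / t - exp (- t) / t - 1)) (at t)"
      using DERIV_diff[OF d[OF t(1)] DERIV_ident] by simp
    then show "\<exists>y. ((\<lambda>t. E1 t + ln t - t) has_real_derivative y) (at t) \<and> y \<le> 0"
      using exp_minus_slope(2)[of t] t assms by fastforce
  qed (use assms in simp)
  then show "ln (1 / x) - 1 \<le> E1 x"
    using assms E1_nonneg[of 1] by (simp add: ln_div)
qed

lemma E1_log_asymp: "((\<lambda>x. E1 x / ln (1 / x)) \<longlongrightarrow> 1) (at_right 0)"
proof (rule tendsto_sandwich)
  have ev: "\<forall>\<^sub>F x in at_right (0::real). 0 < x \<and> x < 1"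
    using eventually_at_right_less by (auto simp: eventually_at_right_field intro: exI[of _ 1])
  show "\<forall>\<^sub>F x in at_right 0. (ln (1 / x) - 1) / ln (1 / x) \<le> E1 x / ln (1 / x)"
    "\<forall>\<^sub>F x in at_right 0. E1 x / ln (1 / x) \<le> (ln (1 / x) + 1) / ln (1 / x)"
    using ev by (eventually_elim; intro divide_right_mono E1_log; simp)+
  show "((\<lambda>x::real. (ln (1 / x) - 1) / ln (1 / x)) \<longlongrightarrow> 1) (at_right 0)" by real_asymp
  show "((\<lambda>x::real. (ln (1 / x) + 1) / ln (1 / x)) \<longlongrightarrow> 1) (at_right 0)" by real_asymp
qed

section \<open>The Poisson equation\<close>

text \<open>
  The relativistic energy. It is a primitive of \<open>dh_g\<close>, which makes \<open>exp (- \<beta> * energy r)\<close> the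
  integrating factor of the equation for \<open>\<psi>\<^sub>\<beta>'\<close>.
\<close>

definition energy :: "real \<Rightarrow> real" where
  "energy r = sqrt (1 + r\<^sup>2)"

lemma energy_ge_1: "1 \<le> energy r"
  by (simp add: energy_def)

lemma energy_pos [simp]: "0 < energy r"
  using energy_ge_1[of r] by simp

lemma energy_nonzero [simp]: "energy r \<noteq> 0"
  using energy_pos[of r] by linarith

lemma energy_ge: "r \<le> energy r"
  unfolding energy_def by (rule real_le_rsqrt) simp

lemma energy_le: "0 \<le> r \<Longrightarrow> energy r \<le> 1 + r"
  unfolding energy_def by (rule real_le_lsqrt) (auto simp: power2_eq_square algebra_simps)

lemma energy_sq: "(energy r)\<^sup>2 = 1 + r\<^sup>2"
  by (simp add: energy_def add_nonneg_nonneg)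

lemma energy_has_derivative:
  "(energy has_real_derivative r / energy r) (at r within S)"
  unfolding energy_def
  by (auto intro!: derivative_eq_intros simp: add_pos_nonneg divide_simps)
    (smt (verit) zero_le_power2)+

lemma continuous_on_energy [continuous_intros]: "continuous_on S energy"
  unfolding energy_def by (intro continuous_intros)

lemma dh_g_energy: "dh_g r = r / energy r"
  by (simp add: dh_g_eq energy_def)

lemma dh_h_energy: "dh_h r = r / (energy r)\<^sup>2"
  by (simp add: dh_h_eq energy_sq)

lemma continuous_on_E1 [continuous_intros]:
  assumes "continuous_on S f" "\<And>x. x \<in> S \<Longrightarrow> 0 < f x"
  shows "continuous_on S (\<lambda>x. E1 (f x))"
proof -
  have "continuous_on {0<..} E1"
    by (rule DERIV_continuous_on, rule has_field_derivative_at_within, rule E1_has_derivative) simp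
  from continuous_on_compose2[OF this assms(1)] assms(2) show ?thesis by auto
qed

text \<open>
  The source term of the equation, multiplied by the integrating factor, has an explicit primitive
  because \<open>dh_h r = energy' r / energy r\<close>: the substitution \<open>v = \<beta> * energy r\<close> turns it into the
  integrand of \<open>E1\<close>.
\<close>

lemma E1_energy_has_derivative:
  assumes "0 < \<beta>"
  shows "((\<lambda>r. E1 (\<beta> * energy r)) has_real_derivative
    - dh_h r * exp (- \<beta> * energy r)) (at r within S)"
proof -
  have "(E1 has_real_derivative - exp (- (\<beta> * energy r)) / (\<beta> * energy r)) (at (\<beta> * energy r))"
    using assms by (intro E1_has_derivative) auto
  moreover have "((\<lambda>r. \<beta> * energy r) has_real_derivative \<beta> * (r / energy r)) (at r within S)"
    by (intro DERIV_cmult energy_has_derivative)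
  ultimately have "((\<lambda>r. E1 (\<beta> * energy r)) has_real_derivative
      - exp (- (\<beta> * energy r)) / (\<beta> * energy r) * (\<beta> * (r / energy r))) (at r within S)"
    by (rule DERIV_chain2)
  then show ?thesis
    using assms by (simp add: dh_h_energy power2_eq_square mult_ac)
qed

text \<open>
  Variation of constants, integrating the source term from \<open>r\<close> to infinity: this choice of the
  constant removes the component \<open>exp (\<beta> * energy r)\<close> and leaves a bounded function.
\<close>

definition psi_deriv :: "real \<Rightarrow> real \<Rightarrow> real" where
  "psi_deriv \<beta> r = \<beta> * exp (\<beta> * energy r) * E1 (\<beta> * energy r)"

lemma psi_deriv_has_derivative:
  assumes "0 < \<beta>"
  shows "(psi_deriv \<beta> has_real_derivative \<beta> * dh_g r * psi_deriv \<beta> r - \<beta> * dh_h r) (at r within S)"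
proof -
  have "exp (\<beta> * energy r) * exp (- \<beta> * energy r) = 1"
    by (simp flip: exp_add)
  then show ?thesis
    unfolding psi_deriv_def [abs_def]
    by (auto intro!: derivative_eq_intros energy_has_derivative E1_energy_has_derivative assms
        simp: dh_g_energy) (simp add: algebra_simps)
qed

lemma continuous_on_psi_deriv [continuous_intros]:
  "0 < \<beta> \<Longrightarrow> continuous_on S (psi_deriv \<beta>)"
  by (rule DERIV_continuous_on) (rule psi_deriv_has_derivative)

lemma psi_deriv_nonneg: "0 < \<beta> \<Longrightarrow> 0 \<le> psi_deriv \<beta> r"
  by (simp add: psi_deriv_def E1_nonneg)

lemma psi_deriv_le:
  assumes "0 < \<beta>" shows "psi_deriv \<beta> r \<le> 1 / energy r"
proof -
  have "psi_deriv \<beta> r \<le> \<beta> * exp (\<beta> * energy r) * (exp (- (\<beta> * energy r)) / (\<beta> * energy r))"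
    unfolding psi_deriv_def using assms by (intro mult_left_mono E1_le) auto
  also have "\<dots> = 1 / energy r"
    using assms by (simp flip: exp_add add: exp_minus divide_simps)
  finally show ?thesis .
qed

lemma psi_deriv_le_1: "0 < \<beta> \<Longrightarrow> psi_deriv \<beta> r \<le> 1"
  using psi_deriv_le[of \<beta> r] energy_ge_1[of r] by (auto intro: order_trans)

definition psi :: "real \<Rightarrow> real \<Rightarrow> real" where
  "psi \<beta> r = (if r < 0 then 0 else LBINT s=0..r. psi_deriv \<beta> s)"

lemma psi_0 [simp]: "psi \<beta> 0 = 0"
  by (simp add: psi_def zero_ereal_def)

lemma psi_has_derivative:
  assumes "0 < \<beta>" "0 \<le> r"
  shows "(psi \<beta> has_real_derivative psi_deriv \<beta> r) (at r within {0..})"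
proof -
  have "((\<lambda>u. LBINT s=ereal 0..ereal u. psi_deriv \<beta> s) has_vector_derivative psi_deriv \<beta> r)
      (at r within {- 1..r + 1})"
    using assms by (intro interval_integral_FTC2) (auto intro!: continuous_intros)
  then have "((\<lambda>u. LBINT s=ereal 0..ereal u. psi_deriv \<beta> s) has_real_derivative psi_deriv \<beta> r) (at r)"
    using assms by (subst (asm) at_within_interior) (auto simp: has_real_derivative_iff_has_vector_derivative)
  then have "((\<lambda>u. LBINT s=ereal 0..ereal u. psi_deriv \<beta> s) has_real_derivative psi_deriv \<beta> r) (at r within {0..})"
    by (rule has_field_derivative_at_within)
  then show ?thesis
    by (rule has_field_derivative_transform_within[OF _ zero_less_one])
      (use assms in \<open>auto simp: psi_def zero_ereal_def\<close>)
qed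

lemma psi_bounds:
  assumes "0 < \<beta>" "0 \<le> r" shows "0 \<le> psi \<beta> r" "psi \<beta> r \<le> r"
proof -
  have d: "(psi \<beta> has_vector_derivative psi_deriv \<beta> x) (at x within {0..r})" if "x \<in> {0..r}" for x
    using psi_has_derivative[OF assms(1), of x] that DERIV_subset[of _ _ x "{0..}" "{0..r}"]
    by (auto simp: has_real_derivative_iff_has_vector_derivative)
  have i: "(psi_deriv \<beta> has_integral psi \<beta> r - psi \<beta> 0) {0..r}"
    using assms d by (intro fundamental_theorem_of_calculus) auto
  show "0 \<le> psi \<beta> r"
    using has_integral_nonneg[OF i] psi_deriv_nonneg[OF assms(1)] by simp
  show "psi \<beta> r \<le> r"
    using has_integral_le[OF i has_integral_const_real[of 1]] psi_deriv_le_1[OF assms(1)] assms by simp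
qed

text \<open>
  Solutions of the homogeneous equation are multiples of \<open>exp (\<beta> * energy r) \<ge> exp (\<beta> * r)\<close>, so a
  growth rate below \<open>\<beta>\<close> leaves only the zero solution.
\<close>

lemma homogeneous_zero:
  assumes deriv: "\<And>r. 0 \<le> r \<Longrightarrow> (y has_real_derivative \<beta> * dh_g r * y r) (at r within {0..})"
    and growth: "y \<in> O[at_top](\<lambda>r. exp (c * r))" and "c < \<beta>" "0 < \<beta>" "0 \<le> r"
  shows "y r = 0"
proof -
  have "\<exists>C. \<forall>r\<in>{0..}. y r * exp (- \<beta> * energy r) = C"
  proof (rule has_field_derivative_zero_constant)
    fix r :: real assume "r \<in> {0..}"
    then show "((\<lambda>r. y r * exp (- \<beta> * energy r)) has_real_derivative 0) (at r within {0..})"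
      by (auto intro!: derivative_eq_intros deriv energy_has_derivative simp: dh_g_energy)
  qed simp
  then obtain C where C: "\<And>r. 0 \<le> r \<Longrightarrow> y r * exp (- \<beta> * energy r) = C" by auto
  obtain K where K: "\<forall>\<^sub>F r in at_top. norm (y r) \<le> K * norm (exp (c * r))"
    using growth by (elim landau_o.bigE)
  have "\<forall>\<^sub>F r in at_top. \<bar>C\<bar> \<le> K * exp ((c - \<beta>) * r)"
    using K eventually_ge_at_top[of 0]
  proof eventually_elim
    case (elim r)
    have "\<bar>C\<bar> = \<bar>y r\<bar> * exp (- \<beta> * energy r)"
      using C[of r] elim by (auto simp: abs_mult)
    also have "\<dots> \<le> \<bar>y r\<bar> * exp (- \<beta> * r)"
      using energy_ge[of r] \<open>0 < \<beta>\<close> by (intro mult_left_mono) auto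
    also have "\<dots> \<le> (K * exp (c * r)) * exp (- \<beta> * r)"
      using elim by (intro mult_right_mono) auto
    also have "\<dots> = K * exp ((c - \<beta>) * r)"
      by (simp flip: exp_add add: algebra_simps)
    finally show ?case .
  qed
  moreover have "((\<lambda>r. K * exp ((c - \<beta>) * r)) \<longlongrightarrow> K * 0) at_top"
  proof -
    have "filterlim (\<lambda>r. (c - \<beta>) * r) at_bot at_top"
      using \<open>c < \<beta>\<close> by (intro filterlim_tendsto_neg_mult_at_bot[OF tendsto_const]) (auto simp: filterlim_ident)
    then show ?thesis
      by (intro tendsto_intros filterlim_compose[OF exp_at_bot])
  qed
  ultimately have "\<bar>C\<bar> \<le> K * 0"
    by (intro tendsto_lowerbound) auto
  then show ?thesis using C[OF \<open>0 \<le> r\<close>] by simp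
qed

lemma psi_solution:
  assumes "0 < \<epsilon>" "0 < \<beta>" shows "dh_psi_solution \<epsilon> \<beta> (psi \<beta>)"
  unfolding dh_psi_solution_def
proof (intro exI conjI allI impI)
  \<comment> \<open>As \<open>psi\<close> grows at most linearly, every positive rate is admissible.\<close>
  let ?c = "\<beta> * \<epsilon> / 4"
  show "(psi \<beta> has_real_derivative psi_deriv \<beta> r) (at r within {0..})" if "0 \<le> r" for r
    using psi_has_derivative[OF assms(2) that] .
  show "(psi_deriv \<beta> has_real_derivative \<beta> * dh_g r * psi_deriv \<beta> r - \<beta> * dh_h r) (at r within {0..})" for r
    by (rule psi_deriv_has_derivative[OF assms(2)])
  show "continuous_on {0..} (\<lambda>r. \<beta> * dh_g r * psi_deriv \<beta> r - \<beta> * dh_h r)"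
    unfolding dh_g_energy dh_h_energy by (intro continuous_intros assms) auto
  show "?c < \<beta> * \<epsilon> / 2" using assms by simp
  have "psi \<beta> \<in> O[at_top](\<lambda>r. r)"
    using psi_bounds[OF assms(2)]
    by (intro bigoI[where c = 1] eventually_mono[OF eventually_ge_at_top[of 0]]) auto
  also have "(\<lambda>r. r) \<in> O[at_top](\<lambda>r. exp (?c * r))"
    using assms by real_asymp
  finally show "psi \<beta> \<in> O[at_top](\<lambda>r. exp (?c * r))" .
  have "psi_deriv \<beta> \<in> O[at_top](\<lambda>r. 1)"
    using psi_deriv_nonneg[OF assms(2)] psi_deriv_le_1[OF assms(2)]
    by (intro bigoI[where c = 1] always_eventually) auto
  also have "(\<lambda>r. 1) \<in> O[at_top](\<lambda>r. exp (?c * r))"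
    using assms by real_asymp
  finally show "psi_deriv \<beta> \<in> O[at_top](\<lambda>r. exp (?c * r))" .
qed auto

lemma psi_solution_unique:
  assumes "\<epsilon> < 1" "0 < \<beta>" and u: "dh_psi_solution \<epsilon> \<beta> u" and v: "dh_psi_solution \<epsilon> \<beta> v"
    and "0 \<le> r"
  shows "u r = v r"
proof -
  obtain u' u'' c where u:
    "\<And>r. 0 \<le> r \<Longrightarrow> (u has_real_derivative u' r) (at r within {0..})"
    "\<And>r. 0 \<le> r \<Longrightarrow> (u' has_real_derivative u'' r) (at r within {0..})"
    "\<And>r. 0 \<le> r \<Longrightarrow> u'' r - \<beta> * dh_g r * u' r + \<beta> * dh_h r = 0"
    "u 0 = 0" "c < \<beta> * \<epsilon> / 2" "u' \<in> O[at_top](\<lambda>r. exp (c * r))"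
    using u unfolding dh_psi_solution_def by blast
  obtain v' v'' d where v:
    "\<And>r. 0 \<le> r \<Longrightarrow> (v has_real_derivative v' r) (at r within {0..})"
    "\<And>r. 0 \<le> r \<Longrightarrow> (v' has_real_derivative v'' r) (at r within {0..})"
    "\<And>r. 0 \<le> r \<Longrightarrow> v'' r - \<beta> * dh_g r * v' r + \<beta> * dh_h r = 0"
    "v 0 = 0" "d < \<beta> * \<epsilon> / 2" "v' \<in> O[at_top](\<lambda>r. exp (d * r))"
    using v unfolding dh_psi_solution_def by blast
  have mono: "(\<lambda>r. exp (a * r)) \<in> O[at_top](\<lambda>r. exp (b * r))" if "a \<le> b" for a b :: real
    using that
    by (intro bigoI[where c = 1] eventually_mono[OF eventually_ge_at_top[of 0]]) (auto intro: mult_right_mono)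
  have "u' r - v' r = 0" if "0 \<le> r" for r
  proof (rule homogeneous_zero[where y = "\<lambda>r. u' r - v' r"])
    show "((\<lambda>r. u' r - v' r) has_real_derivative \<beta> * dh_g r * (u' r - v' r)) (at r within {0..})"
      if "0 \<le> r" for r
    proof -
      have "u'' r - v'' r = \<beta> * dh_g r * (u' r - v' r)"
        using u(3)[OF that] v(3)[OF that] by (simp add: algebra_simps)
      then show ?thesis using DERIV_diff[OF u(2)[OF that] v(2)[OF that]] by simp
    qed
    show "(\<lambda>r. u' r - v' r) \<in> O[at_top](\<lambda>r. exp (max c d * r))"
      by (intro sum_in_bigo landau_o.big_trans[OF u(6) mono] landau_o.big_trans[OF v(6) mono]) auto
    have "\<beta> * \<epsilon> / 2 < \<beta>" using mult_strict_left_mono[OF \<open>\<epsilon> < 1\<close> \<open>0 < \<beta>\<close>] \<open>0 < \<beta>\<close> by simp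
    then show "max c d < \<beta>" using u(5) v(5) by simp
  qed fact+
  then have "((\<lambda>r. u r - v r) has_real_derivative 0) (at r within {0..})" if "r \<in> {0..}" for r
    using DERIV_diff[OF u(1) v(1), of r] that by simp
  from has_field_derivative_zero_constant[OF _ this]
  obtain C where "\<forall>r\<in>{0..}. u r - v r = C" by auto
  from bspec[OF this, of r] bspec[OF this, of 0] u(4) v(4) \<open>0 \<le> r\<close> show ?thesis by simp
qed

lemma dh_psi_eq:
  assumes "0 < \<epsilon>" "\<epsilon> < 1" "0 < \<beta>" shows "dh_psi \<epsilon> \<beta> = psi \<beta>"
  unfolding dh_psi_def
proof (rule the_equality)
  show "dh_psi_solution \<epsilon> \<beta> (psi \<beta>) \<and> (\<forall>r<0. psi \<beta> r = 0)"
    using psi_solution[OF assms(1,3)] by (simp add: psi_def)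
next
  fix u assume u: "dh_psi_solution \<epsilon> \<beta> u \<and> (\<forall>r<0. u r = 0)"
  show "u = psi \<beta>"
  proof
    fix r show "u r = psi \<beta> r"
      using psi_solution_unique[OF assms(2,3) _ psi_solution[OF assms(1,3)], of u r] u
      by (cases "r < 0") (auto simp: psi_def)
  qed
qed

section \<open>The two integrals in the variance\<close>

definition numer :: "real \<Rightarrow> real" where
  "numer \<beta> = (LBINT r:{0..}. psi_deriv \<beta> r * E1 (\<beta> * energy r))"

definition denom :: "real \<Rightarrow> real" where
  "denom \<beta> = (LBINT r:{0..}. exp (- \<beta> * energy r) / energy r)"

lemma exp_energy_le: "0 < \<beta> \<Longrightarrow> exp (- \<beta> * energy r) \<le> exp (- \<beta> * r)"
  using energy_ge[of r] by simp

lemma E1_energy_le: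
  assumes "0 < \<beta>" shows "E1 (\<beta> * energy r) \<le> 1 / \<beta> * exp (- \<beta> * energy r)"
proof -
  have "E1 (\<beta> * energy r) \<le> exp (- (\<beta> * energy r)) / (\<beta> * energy r)"
    using assms by (intro E1_le) auto
  also have "\<dots> \<le> exp (- (\<beta> * energy r)) / \<beta>"
    using assms energy_ge_1[of r] by (intro divide_left_mono) auto
  finally show ?thesis by simp
qed

lemma weight_integrable:
  assumes "0 < \<beta>" and "continuous_on {0..} f" and "\<And>r. 0 \<le> r \<Longrightarrow> \<bar>f r\<bar> \<le> C"
  shows "set_integrable lborel {0..} (\<lambda>r. exp (- \<beta> * energy r) * f r)"
proof (rule set_integrable_exp_decay[OF assms(1)])
  show "continuous_on {0..} (\<lambda>r. exp (- \<beta> * energy r) * f r)"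
    by (intro continuous_intros assms)
  show "\<bar>exp (- \<beta> * energy r) * f r\<bar> \<le> C * exp (- \<beta> * r)" if "0 \<le> r" for r
    using mult_mono[OF exp_energy_le[OF assms(1), of r] assms(3)[OF that]]
    by (simp add: abs_mult mult.commute)
qed

lemma inverse_energy_power_bounded: "\<bar>1 / energy r ^ n\<bar> \<le> 1"
  using one_le_power[OF energy_ge_1, of r n] by (simp add: less_imp_le)

lemma momentum_fraction_bounded: "\<bar>r\<^sup>2 / (energy r)\<^sup>2\<bar> \<le> 1"
proof -
  have "r\<^sup>2 / (1 + r\<^sup>2) \<le> 1" by (subst divide_le_eq_1_pos) (auto simp: add_pos_nonneg)
  then show ?thesis by (simp add: energy_sq)
qed

lemma weight_moments_integrable:
  assumes "0 < \<beta>"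
  shows "set_integrable lborel {0..} (\<lambda>r. exp (- \<beta> * energy r) * (1 / energy r ^ n))"
    and "set_integrable lborel {0..} (\<lambda>r. exp (- \<beta> * energy r) * (r\<^sup>2 / (energy r)\<^sup>2))"
proof -
  have "continuous_on {0..} (\<lambda>r. 1 / energy r ^ n)" "continuous_on {0..} (\<lambda>r. r\<^sup>2 / (energy r)\<^sup>2)"
    by (intro continuous_intros; simp)+
  from weight_integrable[OF assms this(1) inverse_energy_power_bounded]
    weight_integrable[OF assms this(2) momentum_fraction_bounded]
  show "set_integrable lborel {0..} (\<lambda>r. exp (- \<beta> * energy r) * (1 / energy r ^ n))"
    and "set_integrable lborel {0..} (\<lambda>r. exp (- \<beta> * energy r) * (r\<^sup>2 / (energy r)\<^sup>2))" .
qed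

lemma denom_integrable:
  assumes "0 < \<beta>" shows "set_integrable lborel {0..} (\<lambda>r. exp (- \<beta> * energy r) / energy r)"
  using weight_moments_integrable(1)[OF assms, of 1] by simp

lemma numer_integrable:
  assumes "0 < \<beta>" shows "set_integrable lborel {0..} (\<lambda>r. psi_deriv \<beta> r * E1 (\<beta> * energy r))"
proof (rule set_integrable_exp_decay[OF assms])
  show "continuous_on {0..} (\<lambda>r. psi_deriv \<beta> r * E1 (\<beta> * energy r))"
    using assms by (intro continuous_intros) auto
  fix r :: real
  have "psi_deriv \<beta> r * E1 (\<beta> * energy r) \<le> 1 * (1 / \<beta> * exp (- \<beta> * r))"
    using assms psi_deriv_le_1 E1_energy_le[OF assms, of r] exp_energy_le[OF assms, of r]
    by (intro mult_mono order_trans[OF E1_energy_le[OF assms]] mult_left_mono) (auto simp: E1_nonneg)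
  then show "\<bar>psi_deriv \<beta> r * E1 (\<beta> * energy r)\<bar> \<le> 1 / \<beta> * exp (- \<beta> * r)"
    using assms by (simp add: abs_mult psi_deriv_nonneg E1_nonneg)
qed

text \<open>
  The weight in the numerator is minus the derivative of \<open>E1 (\<beta> * energy r)\<close>, so integration by parts
  trades the function \<open>psi\<close>, itself an integral, for its closed-form derivative. The boundary
  terms vanish because \<open>psi \<beta> 0 = 0\<close> and \<open>psi\<close> grows at most linearly.
\<close>

lemma numer_by_parts:
  assumes "0 < \<beta>"
  shows "(LBINT r:{0..}. psi \<beta> r * exp (- \<beta> * energy r) * dh_h r) = numer \<beta>"
proof -
  let ?H = "\<lambda>r. E1 (\<beta> * energy r)" and ?k = "\<lambda>r. psi \<beta> r * exp (- \<beta> * energy r) * dh_h r"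
  have cont_psi: "continuous_on {0..} (psi \<beta>)"
    by (rule DERIV_continuous_on) (rule psi_has_derivative[OF assms], simp)
  have h: "0 \<le> r * dh_h r" "r * dh_h r \<le> 1" "0 \<le> dh_h r" if "0 \<le> r" for r
    using that by (auto simp: dh_h_eq power2_eq_square divide_simps add_pos_nonneg)
  have cont_k: "continuous_on {0..} ?k"
    unfolding dh_h_energy by (intro continuous_intros cont_psi) auto
  have int_k: "set_integrable lborel {0..} ?k"
  proof (rule set_integrable_exp_decay[OF assms cont_k])
    fix r :: real assume r: "0 \<le> r"
    have "\<bar>?k r\<bar> = (psi \<beta> r * dh_h r) * exp (- \<beta> * energy r)"
      using psi_bounds(1)[OF assms r] h[OF r] by (simp add: abs_mult)
    also have "\<dots> \<le> 1 * exp (- \<beta> * r)"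
      using psi_bounds[OF assms r] h[OF r] exp_energy_le[OF assms, of r]
      by (intro mult_mono order_trans[OF mult_right_mono h(2)[OF r]]) auto
    finally show "\<bar>?k r\<bar> \<le> 1 * exp (- \<beta> * r)" .
  qed
  have "(LBINT r:{0..}. psi_deriv \<beta> r * ?H r - ?k r) = 0 - psi \<beta> 0 * ?H 0"
  proof (rule set_integral_FTC_atLeast)
    show "((\<lambda>r. psi \<beta> r * ?H r) has_real_derivative psi_deriv \<beta> r * ?H r - ?k r) (at r within {0..})"
      if "0 \<le> r" for r
      using DERIV_mult[OF psi_has_derivative[OF assms that] E1_energy_has_derivative[OF assms]]
      by (simp add: algebra_simps)
    show "continuous_on {0..} (\<lambda>r. psi_deriv \<beta> r * ?H r - ?k r)"
      using assms by (intro continuous_on_diff cont_k) (auto intro!: continuous_intros)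
    show "set_integrable lborel {0..} (\<lambda>r. psi_deriv \<beta> r * ?H r - ?k r)"
      by (intro set_integral_diff numer_integrable assms int_k)
    show "((\<lambda>r. psi \<beta> r * ?H r) \<longlongrightarrow> 0) at_top"
    proof (rule tendsto_sandwich[of "\<lambda>_. 0" _ _ "\<lambda>r. r * (1 / \<beta> * exp (- \<beta> * r))"])
      show "\<forall>\<^sub>F r in at_top. 0 \<le> psi \<beta> r * ?H r"
        using eventually_ge_at_top[of 0]
        by eventually_elim (use assms in \<open>auto simp: psi_bounds E1_nonneg\<close>)
      show "\<forall>\<^sub>F r in at_top. psi \<beta> r * ?H r \<le> r * (1 / \<beta> * exp (- \<beta> * r))"
        using eventually_ge_at_top[of 0]
      proof eventually_elim
        case (elim r)
        show ?case
          using assms elim exp_energy_le[OF assms, of r]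
          by (intro mult_mono psi_bounds order_trans[OF E1_energy_le[OF assms]] mult_left_mono)
            (auto simp: E1_nonneg)
      qed
      show "((\<lambda>r. r * (1 / \<beta> * exp (- \<beta> * r))) \<longlongrightarrow> 0) at_top"
        using assms by real_asymp
    qed simp
  qed
  then show ?thesis
    unfolding set_integral_diff(2)[OF numer_integrable[OF assms] int_k] numer_def by simp
qed

lemma dh_variance_eq:
  assumes "0 < \<epsilon>" "\<epsilon> < 1" "0 < \<beta>"
  shows "dh_variance \<epsilon> \<beta> = 2 * (numer \<beta> / denom \<beta>)"
  using numer_by_parts[OF assms(3)]
  unfolding dh_variance_def dh_psi_eq[OF assms] denom_def by (simp add: energy_def dh_h_eq)

section \<open>Size of the normalising integral\<close>

text \<open>
  Replacing the energy by its upper bound \<open>1 + r\<close> in the normalising integral gives exactly \<open>E1 \<beta>\<close>.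
  Since the energy and \<open>1 + r\<close> agree to leading order at infinity, where the logarithm arises, this
  approximation costs only a bounded amount as \<open>\<beta>\<close> tends to \<open>0\<close>.
\<close>

lemma E1_shift_integral:
  assumes "0 < \<beta>"
  shows "set_integrable lborel {0..} (\<lambda>r. exp (- \<beta> * (1 + r)) / (1 + r))"
    and "(LBINT r:{0..}. exp (- \<beta> * (1 + r)) / (1 + r)) = E1 \<beta>"
proof -
  have cont: "continuous_on {0..} (\<lambda>r. exp (- \<beta> * (1 + r)) / (1 + r))"
    by (intro continuous_intros) auto
  show int: "set_integrable lborel {0..} (\<lambda>r. exp (- \<beta> * (1 + r)) / (1 + r))"
  proof (rule set_integrable_exp_decay[OF assms cont])
    fix r :: real assume "0 \<le> r"
    then have "exp (- \<beta> * (1 + r)) / (1 + r) \<le> exp (- \<beta> * r) / 1"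
      using assms by (intro frac_le) auto
    then show "\<bar>exp (- \<beta> * (1 + r)) / (1 + r)\<bar> \<le> 1 * exp (- \<beta> * r)"
      using \<open>0 \<le> r\<close> by simp
  qed
  have "(LBINT r:{0..}. exp (- \<beta> * (1 + r)) / (1 + r)) = 0 - (- E1 (\<beta> * (1 + 0)))"
  proof (rule set_integral_FTC_atLeast[OF _ cont int])
    fix r :: real assume "0 \<le> r"
    then have "((\<lambda>r. E1 (\<beta> * (1 + r))) has_real_derivative
        - exp (- (\<beta> * (1 + r))) / (\<beta> * (1 + r)) * \<beta>) (at r within {0..})"
      using assms by (intro DERIV_chain2[OF E1_has_derivative]) (auto intro!: derivative_eq_intros)
    from DERIV_minus[OF this]
    show "((\<lambda>r. - E1 (\<beta> * (1 + r))) has_real_derivative exp (- \<beta> * (1 + r)) / (1 + r)) (at r within {0..})"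
      using assms by simp
  next
    have "filterlim (\<lambda>r. \<beta> * (1 + r)) at_top at_top"
      using assms by real_asymp
    from tendsto_minus[OF filterlim_compose[OF E1_tendsto_0 this]]
    show "((\<lambda>r. - E1 (\<beta> * (1 + r))) \<longlongrightarrow> 0) at_top" by simp
  qed
  then show "(LBINT r:{0..}. exp (- \<beta> * (1 + r)) / (1 + r)) = E1 \<beta>" by simp
qed

lemma denom_ge:
  assumes "0 < \<beta>" shows "E1 \<beta> \<le> denom \<beta>"
  unfolding denom_def E1_shift_integral(2)[OF assms, symmetric]
proof (rule set_integral_mono[OF E1_shift_integral(1)[OF assms] denom_integrable[OF assms]])
  fix r :: real assume "r \<in> {0..}"
  then show "exp (- \<beta> * (1 + r)) / (1 + r) \<le> exp (- \<beta> * energy r) / energy r"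
    using assms energy_le[of r] by (intro frac_le) auto
qed

lemma denom_pos:
  assumes "0 < \<beta>" shows "0 < denom \<beta>"
proof -
  have "0 < exp (- \<beta>) / (\<beta> + 1)" using assms by simp
  also have "\<dots> \<le> denom \<beta>" using E1_ge[OF assms] denom_ge[OF assms] by simp
  finally show ?thesis .
qed

lemma inverse_square_integral:
  shows "set_integrable lborel {0..} (\<lambda>r::real. 2 / (1 + r)\<^sup>2)"
    and "(LBINT r:{0..}. 2 / (1 + r)\<^sup>2) = (2::real)"
proof -
  have cont: "continuous_on {0..} (\<lambda>r::real. 2 / (1 + r)\<^sup>2)"
    by (intro continuous_intros) auto
  have fin: "((\<lambda>r::real. 2 / (1 + r)\<^sup>2) has_integral (- 2 / (1 + b) - (- 2 / (1 + 0)))) {0..b}" if "0 \<le> b" for b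
    using that
    by (intro fundamental_theorem_of_calculus)
      (auto intro!: derivative_eq_intros simp flip: has_real_derivative_iff_has_vector_derivative
        simp: power2_eq_square)
  have has: "((\<lambda>r::real. 2 / (1 + r)\<^sup>2) has_integral 2) {0..}"
  proof (rule has_integral_to_inf)
    show "((\<lambda>b. integral {0..b} (\<lambda>r::real. 2 / (1 + r)\<^sup>2)) \<longlongrightarrow> 2) at_top"
    proof (rule Lim_transform_eventually)
      show "((\<lambda>b::real. - 2 / (1 + b) - (- 2 / (1 + 0))) \<longlongrightarrow> 2) at_top" by real_asymp
      show "\<forall>\<^sub>F b in at_top. - 2 / (1 + b) - (- 2 / (1 + 0)) = integral {0..b} (\<lambda>r::real. 2 / (1 + r)\<^sup>2)"
        using eventually_ge_at_top[of 0] by eventually_elim (metis fin integral_unique)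
    qed
    show "(\<lambda>r::real. 2 / (1 + r)\<^sup>2) integrable_on {0..b}" for b
      by (intro integrable_continuous_interval continuous_on_subset[OF cont]) auto
  qed auto
  then have i: "(\<lambda>r::real. 2 / (1 + r)\<^sup>2) integrable_on {0..}" by blast
  show int: "set_integrable lborel {0..} (\<lambda>r::real. 2 / (1 + r)\<^sup>2)"
    by (rule set_integrable_lborel_nonneg[OF i _ set_measurable_continuous_on[OF _ cont]]) auto
  show "(LBINT r:{0..}. 2 / (1 + r)\<^sup>2) = (2::real)"
    using set_borel_integral_eq_integral(2)[OF int] integral_unique[OF has] by simp
qed

text \<open>
  The energy is replaced by \<open>1 + r\<close> also in the other direction, at the price of an error whose
  integral over the half-line is \<open>2\<close>.
\<close>

lemma inverse_energy_le:
  assumes "0 \<le> r" shows "1 / energy r \<le> 1 / (1 + r) + 2 / (1 + r)\<^sup>2"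
proof -
  have "(1 + r)\<^sup>2 = (1 + 2 * r) + r * r" by (simp add: power2_eq_square algebra_simps)
  also have "\<dots> \<le> (energy r + 2 * energy r) + energy r * r"
    using assms energy_ge_1[of r] energy_ge[of r] by (intro add_mono mult_mono) auto
  finally have "(1 + r)\<^sup>2 \<le> energy r * (3 + r)" by (simp add: algebra_simps)
  then have "1 / energy r \<le> (3 + r) / (1 + r)\<^sup>2"
    using assms by (simp add: divide_simps mult.commute)
  also have "\<dots> = 1 / (1 + r) + 2 / (1 + r)\<^sup>2"
    using assms by (simp add: divide_simps power2_eq_square)
  finally show ?thesis .
qed

lemma denom_le:
  assumes "0 < \<beta>" shows "denom \<beta> \<le> exp \<beta> * E1 \<beta> + 2"
proof -
  let ?a = "\<lambda>r. exp \<beta> * (exp (- \<beta> * (1 + r)) / (1 + r))" and ?b = "\<lambda>r::real. 2 / (1 + r)\<^sup>2"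
  have ia: "set_integrable lborel {0..} ?a"
    by (intro set_integrable_mult_right E1_shift_integral(1) assms)
  have "denom \<beta> \<le> (LBINT r:{0..}. ?a r + ?b r)"
    unfolding denom_def
  proof (rule set_integral_mono[OF denom_integrable[OF assms] set_integral_add(1)[OF ia inverse_square_integral(1)]])
    fix r :: real assume "r \<in> {0..}"
    then have r: "0 \<le> r" by simp
    have "exp (- \<beta> * energy r) / energy r \<le> exp (- \<beta> * r) * (1 / energy r)"
      using divide_right_mono[OF exp_energy_le[OF assms, of r], of "energy r"] by (simp add: less_imp_le)
    also have "\<dots> \<le> exp (- \<beta> * r) * (1 / (1 + r) + ?b r)"
      by (intro mult_left_mono inverse_energy_le r) simp
    also have "\<dots> \<le> exp (- \<beta> * r) / (1 + r) + 1 * ?b r"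
      unfolding distrib_left using r assms by (intro add_mono mult_right_mono) auto
    also have "exp (- \<beta> * r) / (1 + r) = ?a r"
      by (simp flip: exp_add add: algebra_simps)
    finally show "exp (- \<beta> * energy r) / energy r \<le> ?a r + ?b r" by simp
  qed
  then show ?thesis
    by (simp only: set_integral_add(2)[OF ia inverse_square_integral(1)] set_integral_mult_right
        E1_shift_integral(2)[OF assms] inverse_square_integral(2))
qed

section \<open>Large inverse temperature\<close>

lemma numer_le:
  assumes "0 < \<beta>" shows "\<beta> * numer \<beta> \<le> denom \<beta>"
  unfolding numer_def denom_def set_integral_mult_right[symmetric]
proof (rule set_integral_mono[OF set_integrable_mult_right[OF numer_integrable[OF assms]]
      denom_integrable[OF assms]])
  fix r :: real
  have "psi_deriv \<beta> r * E1 (\<beta> * energy r) \<le> 1 / energy r * (1 / \<beta> * exp (- \<beta> * energy r))"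
    using assms by (intro mult_mono psi_deriv_le E1_energy_le) (auto simp: E1_nonneg less_imp_le)
  from mult_left_mono[OF this, of \<beta>] assms
  show "\<beta> * (psi_deriv \<beta> r * E1 (\<beta> * energy r)) \<le> exp (- \<beta> * energy r) / energy r"
    by simp
qed

text \<open>
  For large \<open>\<beta>\<close> the weight concentrates at \<open>r = 0\<close>. Integrating the derivative of
  \<open>r / energy r * exp (- \<beta> * energy r)\<close>, which vanishes at both ends, expresses this as an exact
  identity, with a gain of the factor \<open>\<beta>\<close>.
\<close>

lemma weight_concentration:
  assumes "0 < \<beta>"
  shows "\<beta> * (LBINT r:{0..}. exp (- \<beta> * energy r) * (r\<^sup>2 / (energy r)\<^sup>2))
    = (LBINT r:{0..}. exp (- \<beta> * energy r) * (1 / energy r ^ 3))" (is "_ * ?I = ?J")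
proof -
  note i = weight_moments_integrable(2)[OF assms] weight_moments_integrable(1)[OF assms, of 3]
  have "(LBINT r:{0..}. exp (- \<beta> * energy r) * (1 / energy r ^ 3)
      - \<beta> * (exp (- \<beta> * energy r) * (r\<^sup>2 / (energy r)\<^sup>2))) = 0 - 0 / energy 0 * exp (- \<beta> * energy 0)"
  proof (rule set_integral_FTC_atLeast)
    fix r :: real
    have "1 / energy r ^ 3 = (energy r * energy r - r * r) / energy r ^ 3"
      using energy_sq[of r] by (simp add: power2_eq_square)
    also have "\<dots> = (1 * energy r - r * (r / energy r)) / (energy r * energy r)"
      by (simp add: field_simps power3_eq_cube)
    finally have cube: "1 / energy r ^ 3 = (1 * energy r - r * (r / energy r)) / (energy r * energy r)" .
    have "((\<lambda>r. r / energy r) has_real_derivative 1 / energy r ^ 3) (at r within {0..})"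
      unfolding cube by (rule DERIV_divide[OF DERIV_ident energy_has_derivative]) simp
    then show "((\<lambda>r. r / energy r * exp (- \<beta> * energy r)) has_real_derivative
        exp (- \<beta> * energy r) * (1 / energy r ^ 3)
        - \<beta> * (exp (- \<beta> * energy r) * (r\<^sup>2 / (energy r)\<^sup>2))) (at r within {0..})"
    proof -
      assume d: "((\<lambda>r. r / energy r) has_real_derivative 1 / energy r ^ 3) (at r within {0..})"
      have "((\<lambda>r. exp (- \<beta> * energy r)) has_real_derivative
          exp (- \<beta> * energy r) * (- \<beta> * (r / energy r))) (at r within {0..})"
        by (auto intro!: derivative_eq_intros energy_has_derivative)
      from DERIV_mult[OF d this] show ?thesis
        by (simp add: power2_eq_square mult_ac)
    qed
  next
    show "((\<lambda>r. r / energy r * exp (- \<beta> * energy r)) \<longlongrightarrow> 0) at_top"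
      unfolding energy_def using assms by real_asymp
  qed (intro continuous_intros set_integral_diff set_integrable_mult_right i; simp)+
  then show ?thesis
    unfolding set_integral_diff(2)[OF i(2) set_integrable_mult_right[OF i(1)]]
      set_integral_mult_right by simp
qed

text \<open>
  Concentration makes the powers of the energy interchangeable: the error between \<open>1 / energy r\<close> and
  \<open>1 / (energy r)\<^sup>2\<close> is at most \<open>r\<^sup>2 / (energy r)\<^sup>2\<close>.
\<close>

lemma second_moment_ge:
  assumes "0 < \<beta>"
  shows "(1 - 1 / \<beta>) * denom \<beta> \<le> (LBINT r:{0..}. exp (- \<beta> * energy r) * (1 / (energy r)\<^sup>2))"
    (is "_ \<le> ?M")
proof -
  let ?K = "LBINT r:{0..}. exp (- \<beta> * energy r) * (r\<^sup>2 / (energy r)\<^sup>2)"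
  note i = weight_moments_integrable[OF assms]
  have "denom \<beta> \<le> (LBINT r:{0..}. exp (- \<beta> * energy r) * (1 / (energy r)\<^sup>2)
      + exp (- \<beta> * energy r) * (r\<^sup>2 / (energy r)\<^sup>2))"
    unfolding denom_def
  proof (rule set_integral_mono[OF denom_integrable[OF assms] set_integral_add(1)[OF i]])
    fix r :: real
    have "1 / (energy r)\<^sup>2 + r\<^sup>2 / (energy r)\<^sup>2 = (energy r)\<^sup>2 / (energy r)\<^sup>2"
      by (simp only: energy_sq[of r] add_divide_distrib)
    then have "1 / energy r \<le> 1 / (energy r)\<^sup>2 + r\<^sup>2 / (energy r)\<^sup>2"
      using energy_ge_1[of r] by simp
    from mult_left_mono[OF this, of "exp (- \<beta> * energy r)"]
    show "exp (- \<beta> * energy r) / energy r \<le> exp (- \<beta> * energy r) * (1 / (energy r)\<^sup>2)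
      + exp (- \<beta> * energy r) * (r\<^sup>2 / (energy r)\<^sup>2)"
      by (simp add: distrib_left)
  qed
  also have "\<dots> = ?M + ?K"
    by (rule set_integral_add(2)[OF i])
  finally have split: "denom \<beta> \<le> ?M + ?K" .
  have "\<beta> * ?K \<le> denom \<beta>"
    unfolding weight_concentration[OF assms] denom_def
  proof (rule set_integral_mono[OF i(1) denom_integrable[OF assms]])
    fix r :: real
    have "1 / energy r ^ 3 \<le> 1 / energy r ^ 1"
      using energy_ge_1[of r] by (intro divide_left_mono power_increasing) auto
    from mult_left_mono[OF this, of "exp (- \<beta> * energy r)"]
    show "exp (- \<beta> * energy r) * (1 / energy r ^ 3) \<le> exp (- \<beta> * energy r) / energy r" by simp
  qed
  then have "?K \<le> denom \<beta> / \<beta>" using assms by (simp add: divide_simps mult.commute)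
  with split show ?thesis by (simp add: algebra_simps)
qed

text \<open>
  Here \<open>exp (- x) / (x + 1) \<le> E1 x\<close> is combined with \<open>\<beta> * energy r + 1 \<le> energy r * (\<beta> + 1)\<close>, which
  splits the denominator into a factor in \<open>\<beta>\<close> and a power of the energy.
\<close>

lemma numer_ge:
  assumes "0 < \<beta>" shows "\<beta> / (\<beta> + 1)\<^sup>2 * ((1 - 1 / \<beta>) * denom \<beta>) \<le> numer \<beta>"
proof -
  have "\<beta> / (\<beta> + 1)\<^sup>2 * (LBINT r:{0..}. exp (- \<beta> * energy r) * (1 / (energy r)\<^sup>2)) \<le> numer \<beta>"
    unfolding numer_def set_integral_mult_right[symmetric]
  proof (rule set_integral_mono[OF set_integrable_mult_right[OF weight_moments_integrable(1)[OF assms]]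
        numer_integrable[OF assms]])
    fix r :: real
    let ?x = "\<beta> * energy r" and ?l = "exp (- (\<beta> * energy r)) / (energy r * (\<beta> + 1))"
    have x: "0 < ?x" "?x + 1 \<le> energy r * (\<beta> + 1)"
      using assms energy_ge_1[of r] by (auto simp: algebra_simps)
    have e: "?l \<le> E1 ?x"
      using x by (intro order_trans[OF divide_left_mono E1_ge]) auto
    have "\<beta> / (\<beta> + 1)\<^sup>2 * (exp (- \<beta> * energy r) * (1 / (energy r)\<^sup>2)) = \<beta> * exp ?x * (?l * ?l)"
    proof -
      have "exp ?x * (exp (- ?x) * exp (- ?x)) = exp (- ?x)" by (simp flip: exp_add)
      then have "\<beta> * exp ?x * (?l * ?l)
          = \<beta> * exp (- ?x) / ((energy r * (\<beta> + 1)) * (energy r * (\<beta> + 1)))"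
        by (simp add: mult.assoc)
      then show ?thesis by (simp add: power2_eq_square mult_ac)
    qed
    also have "\<dots> \<le> \<beta> * exp ?x * (E1 ?x * E1 ?x)"
      using assms e by (intro mult_left_mono mult_mono E1_nonneg) (auto simp: less_imp_le)
    finally show "\<beta> / (\<beta> + 1)\<^sup>2 * (exp (- \<beta> * energy r) * (1 / (energy r)\<^sup>2))
        \<le> psi_deriv \<beta> r * E1 (\<beta> * energy r)"
      by (simp add: psi_deriv_def mult_ac)
  qed
  with mult_left_mono[OF second_moment_ge[OF assms], of "\<beta> / (\<beta> + 1)\<^sup>2"] assms
  show ?thesis by simp
qed

lemma numer_denom_at_top: "((\<lambda>\<beta>. \<beta> * (numer \<beta> / denom \<beta>)) \<longlongrightarrow> 1) at_top"
proof (rule tendsto_sandwich)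
  show "\<forall>\<^sub>F \<beta> in at_top. \<beta>\<^sup>2 / (\<beta> + 1)\<^sup>2 * (1 - 1 / \<beta>) \<le> \<beta> * (numer \<beta> / denom \<beta>)"
    using eventually_gt_at_top[of 1]
  proof eventually_elim
    case (elim \<beta>)
    have "\<beta>\<^sup>2 / (\<beta> + 1)\<^sup>2 * (1 - 1 / \<beta>) = \<beta> * (\<beta> / (\<beta> + 1)\<^sup>2 * ((1 - 1 / \<beta>) * denom \<beta>)) / denom \<beta>"
      using denom_pos[of \<beta>] elim by (simp add: power2_eq_square)
    also have "\<dots> \<le> \<beta> * numer \<beta> / denom \<beta>"
      using denom_pos[of \<beta>] elim by (intro divide_right_mono mult_left_mono numer_ge) auto
    finally show ?case by simp
  qed
  show "\<forall>\<^sub>F \<beta> in at_top. \<beta> * (numer \<beta> / denom \<beta>) \<le> 1"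
    using eventually_gt_at_top[of 0]
    by eventually_elim (use numer_le denom_pos in \<open>simp add: divide_le_eq\<close>)
  show "((\<lambda>\<beta>::real. \<beta>\<^sup>2 / (\<beta> + 1)\<^sup>2 * (1 - 1 / \<beta>)) \<longlongrightarrow> 1) at_top" by real_asymp
qed simp

section \<open>Small inverse temperature\<close>

lemma denom_log_asymp: "((\<lambda>\<beta>. denom \<beta> / ln (1 / \<beta>)) \<longlongrightarrow> 1) (at_right 0)"
proof (rule tendsto_sandwich[OF _ _ E1_log_asymp])
  have ev: "\<forall>\<^sub>F x in at_right (0::real). 0 < x \<and> x < 1"
    by (auto simp: eventually_at_right_field intro: exI[of _ 1])
  show "\<forall>\<^sub>F \<beta> in at_right 0. E1 \<beta> / ln (1 / \<beta>) \<le> denom \<beta> / ln (1 / \<beta>)"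
    using ev by eventually_elim (intro divide_right_mono denom_ge, auto)
  show "\<forall>\<^sub>F \<beta> in at_right 0. denom \<beta> / ln (1 / \<beta>) \<le> exp \<beta> * (E1 \<beta> / ln (1 / \<beta>)) + 2 / ln (1 / \<beta>)"
    using ev
  proof eventually_elim
    case (elim \<beta>)
    then show ?case
      using divide_right_mono[OF denom_le[of \<beta>], of "ln (1 / \<beta>)"] by (simp add: add_divide_distrib)
  qed
  have "((\<lambda>\<beta>::real. exp \<beta>) \<longlongrightarrow> 1) (at_right 0)" "((\<lambda>\<beta>::real. 2 / ln (1 / \<beta>)) \<longlongrightarrow> 0) (at_right 0)"
    by real_asymp+
  from tendsto_add[OF tendsto_mult[OF this(1) E1_log_asymp] this(2)]
  show "((\<lambda>\<beta>. exp \<beta> * (E1 \<beta> / ln (1 / \<beta>)) + 2 / ln (1 / \<beta>)) \<longlongrightarrow> 1) (at_right 0)" by simp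
qed

text \<open>
  The integrand of the numerator is \<open>\<beta>\<close> times this function at \<open>\<beta> * energy r\<close>.
\<close>

definition profile :: "real \<Rightarrow> real" where
  "profile x = exp x * (E1 x)\<^sup>2"

lemma profile_nonneg: "0 \<le> profile x"
  by (simp add: profile_def)

lemma profile_pos:
  assumes "0 < x" shows "0 < profile x"
proof -
  have "0 < exp (- x) / (x + 1)" using assms by simp
  then have "0 < E1 x" using E1_ge[OF assms] by simp
  then show ?thesis by (simp add: profile_def)
qed

lemma continuous_on_profile: "continuous_on {0<..} profile"
  unfolding profile_def [abs_def] by (intro continuous_intros) auto

text \<open>
  A multiple of the integrand of \<open>Gamma (1 / 2)\<close>, hence integrable on the half-line.
\<close>

definition gamma_majorant :: "real \<Rightarrow> real" where
  "gamma_majorant u = 16 * (u powr (1 / 2 - 1) / exp u)"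

lemma gamma_majorant_integrable: "set_integrable lborel {0..} gamma_majorant"
proof -
  have "set_integrable lborel {0..} (\<lambda>u::real. u powr (1 / 2 - 1) / exp u)"
  proof (rule set_integrable_lborel_nonneg)
    show "(\<lambda>u::real. u powr (1 / 2 - 1) / exp u) integrable_on {0..}"
      using Gamma_integral_real[of "1 / 2"] by auto
    show "set_borel_measurable borel {0..} (\<lambda>u::real. u powr (1 / 2 - 1) / exp u)"
      unfolding set_borel_measurable_def by measurable
  qed simp
  then show ?thesis unfolding gamma_majorant_def [abs_def] by (rule set_integrable_mult_right)
qed

lemma profile_le_majorant:
  assumes "0 < u" "u \<le> x" shows "profile x \<le> gamma_majorant u"
proof -
  have x: "0 < x" using assms by simp
  have "profile x \<le> exp x * (4 * exp (- x) * x powr (- 1 / 4))\<^sup>2"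
    unfolding profile_def using x E1_nonneg[OF x] E1_le_powr[OF x] by (intro mult_left_mono power_mono) auto
  also have "\<dots> = 16 * (exp (- x) * x powr (- 1 / 2))"
    using x by (simp add: power2_eq_square powr_add[symmetric] exp_minus divide_simps)
  also have "\<dots> \<le> 16 * (exp (- u) * u powr (- 1 / 2))"
    using assms by (intro mult_left_mono mult_mono powr_mono2') auto
  also have "\<dots> = gamma_majorant u"
    by (simp add: gamma_majorant_def exp_minus divide_simps)
  finally show ?thesis .
qed

text \<open>
  In the variable \<open>u = \<beta> * r\<close> the Jacobian absorbs the factor \<open>\<beta>\<close>, and the remaining dependence on
  \<open>\<beta>\<close> disappears in the limit, since \<open>sqrt (\<beta>\<^sup>2 + u\<^sup>2)\<close> tends to \<open>u\<close>.
\<close>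

lemma numer_rescaled:
  assumes "0 < \<beta>"
  shows "numer \<beta> = (\<integral>u. indicator {0..} u * profile (sqrt (\<beta>\<^sup>2 + u\<^sup>2)) \<partial>lborel)"
proof -
  have s: "sqrt (\<beta>\<^sup>2 + (\<beta> * r)\<^sup>2) = \<beta> * energy r" for r
  proof -
    have "\<beta>\<^sup>2 + (\<beta> * r)\<^sup>2 = \<beta>\<^sup>2 * (1 + r\<^sup>2)" by (simp add: algebra_simps power_mult_distrib)
    then show ?thesis using assms by (simp add: real_sqrt_mult energy_def)
  qed
  have "(\<integral>u. indicator {0..} u * profile (sqrt (\<beta>\<^sup>2 + u\<^sup>2)) \<partial>lborel)
      = \<beta> * (\<integral>r. indicator {0..} (\<beta> * r) * profile (\<beta> * energy r) \<partial>lborel)"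
    using assms by (subst lborel_integral_real_affine[where c = \<beta> and t = 0]) (auto simp: s)
  also have "\<dots> = (\<integral>r. \<beta> * (indicator {0..} (\<beta> * r) * profile (\<beta> * energy r)) \<partial>lborel)"
    by simp
  also have "\<dots> = numer \<beta>"
    unfolding numer_def set_lebesgue_integral_def
    by (rule Bochner_Integration.integral_cong)
      (use assms in \<open>auto simp: indicator_def psi_deriv_def profile_def power2_eq_square zero_le_mult_iff\<close>)
  finally show ?thesis by simp
qed

text \<open>
  Dominated convergence applies because \<open>sqrt (\<beta>\<^sup>2 + u\<^sup>2) \<ge> u\<close> and the majorant decreases: one
  bound in terms of \<open>u\<close> serves all \<open>\<beta>\<close>.
\<close>

lemma numer_at_right_0:
  defines "L \<equiv> (\<integral>u. indicator {0<..} u * profile u \<partial>lborel)"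
  shows "(numer \<longlongrightarrow> L) (at_right 0)" and "0 < L"
proof -
  have meas: "(\<lambda>u. indicator {0<..} u * profile u) \<in> borel_measurable lborel"
    using borel_measurable_continuous_on_indicator[OF _ continuous_on_profile] by simp
  have maj: "integrable lborel (\<lambda>u. indicator {0..} u * gamma_majorant u)"
    using gamma_majorant_integrable by (simp add: set_integrable_def)
  have int: "integrable lborel (\<lambda>u. indicator {0<..} u * profile u)"
    by (rule Bochner_Integration.integrable_bound[OF maj meas])
      (auto simp: indicator_def profile_nonneg intro!: AE_I2 order_trans[OF profile_le_majorant abs_ge_self])
  show "(numer \<longlongrightarrow> L) (at_right 0)"
  proof (rule tendsto_at_right_sequentially[OF zero_less_one])
    fix S :: "nat \<Rightarrow> real" assume S: "\<And>n. 0 < S n" "S \<longlonglongrightarrow> 0"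
    have "(\<lambda>n. \<integral>u. indicator {0..} u * profile (sqrt ((S n)\<^sup>2 + u\<^sup>2)) \<partial>lborel) \<longlonglongrightarrow> L"
      unfolding L_def
    proof (rule integral_dominated_convergence[OF meas _ maj])
      show "(\<lambda>u. indicator {0..} u * profile (sqrt ((S n)\<^sup>2 + u\<^sup>2))) \<in> borel_measurable lborel" for n
      proof -
        have "continuous_on {0..} (\<lambda>u. profile (sqrt ((S n)\<^sup>2 + u\<^sup>2)))"
          by (rule continuous_on_compose2[OF continuous_on_profile])
            (use S(1)[of n] in \<open>auto intro!: continuous_intros add_pos_nonneg\<close>)
        from borel_measurable_continuous_on_indicator[OF _ this] show ?thesis by simp
      qed
      show "AE u in lborel. (\<lambda>n. indicator {0..} u * profile (sqrt ((S n)\<^sup>2 + u\<^sup>2)))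
          \<longlonglongrightarrow> indicator {0<..} u * profile u"
        using AE_lborel_singleton[of 0]
      proof eventually_elim
        case (elim u)
        show ?case
        proof (cases "0 < u")
          case True
          have "(\<lambda>n. sqrt ((S n)\<^sup>2 + u\<^sup>2)) \<longlonglongrightarrow> sqrt (0\<^sup>2 + u\<^sup>2)"
            by (intro tendsto_intros S(2))
          moreover have "isCont profile u"
            using continuous_on_profile True by (simp add: continuous_on_eq_continuous_at)
          ultimately have "(\<lambda>n. profile (sqrt ((S n)\<^sup>2 + u\<^sup>2))) \<longlonglongrightarrow> profile u"
            using True by (intro isCont_tendsto_compose[of u profile]) auto
          then show ?thesis using True by simp
        qed (use elim in auto)
      qed
      show "AE u in lborel. norm (indicator {0..} u * profile (sqrt ((S n)\<^sup>2 + u\<^sup>2)))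
          \<le> indicator {0..} u * gamma_majorant u" for n
        using AE_lborel_singleton[of 0]
      proof eventually_elim
        case (elim u)
        show ?case
        proof (cases "0 < u")
          case True
          have "u \<le> sqrt ((S n)\<^sup>2 + u\<^sup>2)" by (rule real_le_rsqrt) simp
          then show ?thesis using True by (auto simp: profile_nonneg intro!: profile_le_majorant)
        qed (use elim in auto)
      qed
    qed
    then show "(\<lambda>n. numer (S n)) \<longlonglongrightarrow> L" by (simp add: numer_rescaled[OF S(1)])
  qed
  show "0 < L"
  proof (rule ccontr)
    assume "\<not> 0 < L"
    moreover have "0 \<le> L" unfolding L_def by (intro integral_nonneg_AE AE_I2) (simp add: profile_nonneg)
    ultimately have "L = 0" by simp
    then have "AE u in lborel. indicator {0<..} u * profile u = 0"
      unfolding L_def by (subst (asm) integral_nonneg_eq_0_iff_AE[OF int]) (auto simp: profile_nonneg)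
    then have "AE u in lborel. u \<notin> {0<..<1::real}"
      by (rule eventually_mono) (use profile_pos in \<open>force simp: indicator_def\<close>)
    then have "emeasure lborel {0<..<1::real} = 0"
      by (subst (asm) AE_iff_measurable[OF _ refl]) (auto simp: greaterThanLessThan_def Int_def)
    then show False by simp
  qed
qed

theorem proposition4:
  fixes \<epsilon> :: real
  assumes "0 < \<epsilon>" and "\<epsilon> < 1"
  shows "((\<lambda>\<beta>. dh_variance \<epsilon> \<beta>) \<sim>[at_top] (\<lambda>\<beta>. 2 / \<beta>)) \<and>
    (\<exists>A>0. (\<lambda>\<beta>. dh_variance \<epsilon> \<beta>) \<sim>[at_right 0] (\<lambda>\<beta>. A / ln (1 / \<beta>)))"
proof
  have "((\<lambda>\<beta>. dh_variance \<epsilon> \<beta> / (2 / \<beta>)) \<longlongrightarrow> 1) at_top"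
  proof (rule Lim_transform_eventually[OF numer_denom_at_top])
    show "\<forall>\<^sub>F \<beta> in at_top. \<beta> * (numer \<beta> / denom \<beta>) = dh_variance \<epsilon> \<beta> / (2 / \<beta>)"
      using eventually_gt_at_top[of 0] by eventually_elim (simp add: dh_variance_eq[OF assms])
  qed
  then show "(\<lambda>\<beta>. dh_variance \<epsilon> \<beta>) \<sim>[at_top] (\<lambda>\<beta>. 2 / \<beta>)" by (rule asymp_equivI')
next
  define L where "L = (\<integral>u. indicator {0<..} u * profile u \<partial>lborel)"
  have L: "(numer \<longlongrightarrow> L) (at_right 0)" "0 < L"
    unfolding L_def by (rule numer_at_right_0)+
  have "((\<lambda>\<beta>. numer \<beta> / L / (denom \<beta> / ln (1 / \<beta>))) \<longlongrightarrow> L / L / 1) (at_right 0)"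
    using L(2) by (intro tendsto_intros L(1) denom_log_asymp) auto
  then have "((\<lambda>\<beta>. dh_variance \<epsilon> \<beta> / (2 * L / ln (1 / \<beta>))) \<longlongrightarrow> L / L / 1) (at_right 0)"
  proof (rule Lim_transform_eventually)
    show "\<forall>\<^sub>F \<beta> in at_right 0. numer \<beta> / L / (denom \<beta> / ln (1 / \<beta>))
        = dh_variance \<epsilon> \<beta> / (2 * L / ln (1 / \<beta>))"
      using eventually_at_right_less
      by eventually_elim (use L(2) in \<open>simp add: dh_variance_eq[OF assms]\<close>)
  qed
  then have "(\<lambda>\<beta>. dh_variance \<epsilon> \<beta>) \<sim>[at_right 0] (\<lambda>\<beta>. 2 * L / ln (1 / \<beta>))"
    using L(2) by (intro asymp_equivI') simp
  then show "\<exists>A>0. (\<lambda>\<beta>. dh_variance \<epsilon> \<beta>) \<sim>[at_right 0] (\<lambda>\<beta>. A / ln (1 / \<beta>))"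
    using L(2) by (intro exI[of _ "2 * L"]) simp
qed

end
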